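(* Let $M$ be a square complex matrix and let $\tau>0$ be a real number. Then $$\prod_{\lambda\in\mathrm{spec}(M):\ |\lambda|>\tau}\left(\frac{|\lambda|}{\tau}\right)^2\ \le\ \mathbb{E}_{\theta\sim[0,2\pi]}\left|\det\left(I-\frac{e^{\mathrm{i}\theta}}{\tau}\cdot M\right)\right|^2 .$$
   Context: $\mathrm{spec}(M)$ denotes the spectrum (eigenvalues) of $M$, listed with algebraic multiplicity. $I$ is the identity matrix of the same size as $M$, $\mathrm{i}$ is the imaginary unit, and $\theta\sim[0,2\pi]$ means that $\theta$ is uniformly distributed on $[0,2\pi]$. An empty product equals $1$. *)

theory Defs
  imports
    "HOL-Probability.Probability_Measure"
    "HOL-Computational_Algebra.Fundamental_Theorem_Algebra"
    "Jordan_Normal_Form.Spectral_Radius"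
begin

(* HOL-Analysis has another det, on the type of matrices indexed by finite types. *)
hide_const (open) Determinants.det

(* The spectrum as a multiset: the set spectrum M forgets multiplicities, whereas proots counts each
   root of the characteristic polynomial with its order. *)
definition spec :: "complex mat \<Rightarrow> complex multiset" where
  "spec M = proots (char_poly M)"

lemma char_poly_nonzero:
  fixes M :: "complex mat"
  assumes "M \<in> carrier_mat n n"
  shows "char_poly M \<noteq> 0"
  using degree_monic_char_poly[OF assms] by auto

lemma set_mset_spec:
  assumes "M \<in> carrier_mat n n"
  shows "set_mset (spec M) = spectrum M"
  using char_poly_nonzero[OF assms] eigenvalue_root_char_poly[OF assms]
  by (auto simp: spec_def spectrum_def)

lemma count_spec:
  assumes "M \<in> carrier_mat n n"
  shows "count (spec M) z = order z (char_poly M)"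
  using char_poly_nonzero[OF assms] by (simp add: spec_def)

lemma size_spec:
  assumes "M \<in> carrier_mat n n"
  shows "size (spec M) = n"
  using degree_monic_char_poly[OF assms] by (simp add: spec_def size_proots_complex)

end

theory Submission
  imports Defs
begin

text \<open>
  The determinant is the product of the factors \<open>1 - z \<mu>\<close> with \<open>z = e\<^sup>i\<^sup>\<theta>\<close> and \<open>\<mu> = \<lambda> / \<tau>\<close>.
  On the unit circle \<open>1 - z \<mu>\<close> has the same modulus as \<open>cnj \<mu> - z\<close>; making this
  replacement in the factors with \<open>|\<mu>| > 1\<close> yields a polynomial \<open>q\<close> of equal modulus on the
  circle with \<open>|q 0|\<close> equal to the product of the \<open>|\<mu>| > 1\<close>. As \<open>q 0\<close> is the mean of \<open>q\<close>,
  its squared modulus is at most the mean of \<open>|q|\<^sup>2\<close>.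
\<close>

abbreviation uniform_angle :: "real measure" where
  "uniform_angle \<equiv> uniform_measure lborel {0..2 * pi}"

lemma prob_space_uniform_angle: "prob_space uniform_angle"
  by (rule prob_space_uniform_measure) auto

text \<open>The density in \<open>uniform_measure_def\<close> is a quotient in
  \<open>ennreal\<close>. Writing it as \<open>ennreal\<close> of a real function lets
  \<open>integrable_density\<close> and \<open>integral_density\<close> apply.\<close>

lemma uniform_angle_eq_density:
  "uniform_angle = density lborel (\<lambda>x. ennreal (indicator {0..2 * pi} x / (2 * pi)))"
proof -
  have "1 / ennreal (2 * pi) = ennreal (1 / (2 * pi))"
    using divide_ennreal[of 1 "2 * pi"] by simp
  then show ?thesis
    unfolding uniform_measure_def
    by (intro arg_cong2[where f = density]) (auto simp: fun_eq_iff split: split_indicator)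
qed

lemma integrable_uniform_angle:
  fixes f :: "real \<Rightarrow> 'a :: euclidean_space"
  assumes "continuous_on UNIV f"
  shows "integrable uniform_angle f"
proof -
  have [measurable]: "f \<in> borel_measurable borel"
    using assms by (rule borel_measurable_continuous_onI)
  have "integrable lborel (\<lambda>x. (1 / (2 * pi)) *\<^sub>R (indicator {0..2 * pi} x *\<^sub>R f x))"
    by (intro integrable_scaleR_right borel_integrable_compact continuous_on_subset[OF assms]) auto
  then show ?thesis
    unfolding uniform_angle_eq_density by (subst integrable_density) auto
qed

lemma integral_uniform_angle:
  fixes f :: "real \<Rightarrow> 'a :: euclidean_space"
  assumes "continuous_on UNIV f"
  shows "integral\<^sup>L uniform_angle f
    = (1 / (2 * pi)) *\<^sub>R integral\<^sup>L lborel (\<lambda>x. indicator {0..2 * pi} x *\<^sub>R f x)"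
proof -
  have [measurable]: "f \<in> borel_measurable borel"
    using assms by (rule borel_measurable_continuous_onI)
  show ?thesis
    unfolding uniform_angle_eq_density
    by (subst integral_density) (auto simp flip: integral_scaleR_right)
qed

lemma expectation_exp_power:
  assumes "k > 0"
  shows "integral\<^sup>L uniform_angle (\<lambda>\<theta>. exp (\<i> * complex_of_real \<theta>) ^ k) = 0"
proof -
  \<comment> \<open>An antiderivative of the integrand, with nonzero denominator since
    \<open>k > 0\<close>. It has period 2 pi, so its values at the two ends of the interval
    cancel.\<close>
  define F where "F \<theta> = exp (\<i> * complex_of_real \<theta>) ^ k / (\<i> * of_nat k)" for \<theta>
  have "integral\<^sup>L lborel (\<lambda>\<theta>. indicator {0..2 * pi} \<theta> *\<^sub>R exp (\<i> * complex_of_real \<theta>) ^ k)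
      = F (2 * pi) - F 0"
  proof (rule integral_FTC_atLeastAtMost)
    fix \<theta> :: real
    \<comment> \<open>The derivative is taken in a complex variable first and then restricted to the
      real axis.\<close>
    have "((\<lambda>z. exp (\<i> * z) ^ k / (\<i> * of_nat k)) has_field_derivative exp (\<i> * of_real \<theta>) ^ k)
        (at (of_real \<theta>))"
      unfolding exp_of_nat_mult[symmetric] using assms
      by (auto intro!: derivative_eq_intros)
    from has_vector_derivative_real_field[OF this]
    show "(F has_vector_derivative exp (\<i> * of_real \<theta>) ^ k) (at \<theta> within {0..2 * pi})"
      unfolding F_def by (rule has_vector_derivative_at_within)
  qed (auto intro!: continuous_intros)
  also have "\<dots> = 0"
    using exp_two_pi_i by (simp add: F_def mult_ac)
  finally show ?thesis
    by (subst integral_uniform_angle) (auto intro!: continuous_intros)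
qed

text \<open>Mean value property: every monomial of positive degree averages to zero over the circle,
  so only the constant coefficient survives.\<close>

lemma expectation_poly_exp:
  "integral\<^sup>L uniform_angle (\<lambda>\<theta>. poly q (exp (\<i> * complex_of_real \<theta>))) = poly q 0"
proof -
  interpret prob_space uniform_angle
    by (rule prob_space_uniform_angle)
  have "prob UNIV = 1"
    using prob_space by simp
  then have mean: "expectation (\<lambda>\<theta>. exp (\<i> * complex_of_real \<theta>) ^ k) = (if k = 0 then 1 else 0)"
    for k by (simp add: expectation_exp_power del: measure_uniform_measure)
  have "expectation (\<lambda>\<theta>. poly q (exp (\<i> * complex_of_real \<theta>)))
      = (\<Sum>k\<le>degree q. coeff q k * expectation (\<lambda>\<theta>. exp (\<i> * complex_of_real \<theta>) ^ k))"
    unfolding poly_altdef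
    by (subst Bochner_Integration.integral_sum)
      (auto intro!: integrable_uniform_angle continuous_intros)
  also have "\<dots> = (\<Sum>k\<le>degree q. if k = 0 then coeff q k else 0)"
    by (intro sum.cong) (auto simp: mean)
  also have "\<dots> = poly q 0"
    by (simp add: poly_0_coeff_0)
  finally show ?thesis .
qed

lemma norm_poly_0_le_expectation:
  "(cmod (poly q 0))\<^sup>2
    \<le> integral\<^sup>L uniform_angle (\<lambda>\<theta>. (cmod (poly q (exp (\<i> * complex_of_real \<theta>))))\<^sup>2)"
proof -
  interpret prob_space uniform_angle
    by (rule prob_space_uniform_angle)
  define c where "c = poly q 0"
  define g where "g \<theta> = poly q (exp (\<i> * complex_of_real \<theta>))" for \<theta>
  have cont: "continuous_on UNIV g"
    unfolding g_def by (intro continuous_intros)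
  have "(cmod c)\<^sup>2 \<le> (cmod (integral\<^sup>L uniform_angle g))\<^sup>2"
    unfolding g_def c_def by (simp add: expectation_poly_exp)
  also have "\<dots> \<le> (integral\<^sup>L uniform_angle (\<lambda>\<theta>. cmod (g \<theta>)))\<^sup>2"
    by (intro power_mono integral_norm_bound) auto
  \<comment> \<open>Jensen's inequality for the square: the difference of the two sides is the
    variance of \<open>cmod (g \<theta>)\<close>.\<close>
  also have "\<dots> \<le> integral\<^sup>L uniform_angle (\<lambda>\<theta>. (cmod (g \<theta>))\<^sup>2)"
    using variance_positive[of "\<lambda>\<theta>. cmod (g \<theta>)"]
    by (subst (asm) variance_eq) (auto intro!: integrable_uniform_angle continuous_intros cont)
  finally show ?thesis
    by (simp add: c_def g_def)
qed

lemma prod_outside_disc_le_expectation: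
  fixes A :: "complex multiset"
  shows "(\<Prod>\<mu>\<in>#filter_mset (\<lambda>\<mu>. cmod \<mu> > 1) A. (cmod \<mu>)\<^sup>2)
    \<le> integral\<^sup>L uniform_angle (\<lambda>\<theta>. (cmod (\<Prod>\<mu>\<in>#A. 1 - exp (\<i> * complex_of_real \<theta>) * \<mu>))\<^sup>2)"
proof -
  define q where "q = (\<Prod>\<mu>\<in>#A. if cmod \<mu> > 1 then [:cnj \<mu>, -1:] else [:1, -\<mu>:])"
  have reflect: "cmod (cnj \<mu> - z) = cmod (1 - z * \<mu>)" if "cmod z = 1" for z \<mu>
  proof -
    \<comment> \<open>On the unit circle \<open>cnj z\<close> inverts \<open>z\<close>, so it can be
      factored out of the conjugate of \<open>1 - z * \<mu>\<close>, and it has modulus 1.\<close>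
    have "cnj z * z = 1"
      using that complex_norm_square[of z] by (simp add: mult.commute)
    then have "cnj (1 - z * \<mu>) = cnj z * (z - cnj \<mu>)"
      by (simp add: algebra_simps)
    then have "cmod (1 - z * \<mu>) = cmod z * cmod (z - cnj \<mu>)"
      by (metis complex_mod_cnj norm_mult)
    then show ?thesis
      using that by (simp add: norm_minus_commute)
  qed
  have "cmod (poly q z) = cmod (\<Prod>\<mu>\<in>#A. 1 - z * \<mu>)" if "cmod z = 1" for z
    unfolding q_def by (induction A) (auto simp: norm_mult reflect[OF that])
  \<comment> \<open>At 0 a reflected factor equals \<open>cnj \<mu>\<close> and any other factor
    equals 1.\<close>
  moreover have "(cmod (poly q 0))\<^sup>2 = (\<Prod>\<mu>\<in>#filter_mset (\<lambda>\<mu>. cmod \<mu> > 1) A. (cmod \<mu>)\<^sup>2)"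
    unfolding q_def by (induction A) (auto simp: norm_mult power_mult_distrib)
  ultimately show ?thesis
    using norm_poly_0_le_expectation[of q] by simp
qed

lemma poly_char_poly_eq_prod_spec:
  assumes "M \<in> carrier_mat n n"
  shows "poly (char_poly M) x = (\<Prod>z\<in>#spec M. x - z)"
proof -
  have "char_poly M = (\<Prod>z\<in>#spec M. [:-z, 1:])"
    using complex_poly_decompose_multiset[of "char_poly M"] degree_monic_char_poly[OF assms]
    by (simp add: spec_def)
  moreover have "poly (\<Prod>z\<in>#A. [:-z, 1:]) x = (\<Prod>z\<in>#A. x - z)" for A
    by (induction A) (auto simp: algebra_simps)
  ultimately show ?thesis
    by simp
qed

lemma det_one_minus_smult_eq_prod_spec:
  fixes M :: "complex mat"
  assumes M: "M \<in> carrier_mat n n" and "w \<noteq> 0"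
  shows "det (1\<^sub>m n - w \<cdot>\<^sub>m M) = (\<Prod>z\<in>#spec M. 1 - w * z)"
proof -
  \<comment> \<open>Since \<open>- char_matrix M (1 / w)\<close> is \<open>1 / w\<close> times the
    identity minus \<open>M\<close>, this turns the determinant into a value of the characteristic
    polynomial.\<close>
  have "1\<^sub>m n - w \<cdot>\<^sub>m M = w \<cdot>\<^sub>m (- char_matrix M (1 / w))"
    using M \<open>w \<noteq> 0\<close> by (intro eq_matI) (auto simp: char_matrix_def field_simps)
  then have "det (1\<^sub>m n - w \<cdot>\<^sub>m M) = w ^ n * poly (char_poly M) (1 / w)"
    using M char_poly_matrix[OF M] by (simp add: char_matrix_def)
  \<comment> \<open>With the exponent written as the number of eigenvalues, each linear factor can
    absorb one copy of \<open>w\<close>.\<close>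
  also have "\<dots> = w ^ size (spec M) * (\<Prod>z\<in>#spec M. 1 / w - z)"
    by (simp add: size_spec[OF M] poly_char_poly_eq_prod_spec[OF M])
  also have "w ^ size A * (\<Prod>z\<in>#A. 1 / w - z) = (\<Prod>z\<in>#A. 1 - w * z)" for A
    using \<open>w \<noteq> 0\<close> by (induction A) (auto simp: field_simps)
  finally show ?thesis .
qed

theorem theorem1p1:
  fixes M :: "complex mat" and n :: nat and \<tau> :: real
  assumes "M \<in> carrier_mat n n"
    and "\<tau> > 0"
  shows "(\<Prod>z\<in>#filter_mset (\<lambda>z. cmod z > \<tau>) (spec M). (cmod z / \<tau>)\<^sup>2)
    \<le> prob_space.expectation (uniform_measure lborel {0..2 * pi})
        (\<lambda>\<theta>. (cmod (det (1\<^sub>m n - (exp (\<i> * complex_of_real \<theta>) / complex_of_real \<tau>) \<cdot>\<^sub>m M)))\<^sup>2)"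
proof -
  \<comment> \<open>Scaling the eigenvalues by \<open>1 / \<tau>\<close> moves the threshold to the
    unit circle, where the reflection preserves moduli.\<close>
  define A where "A = image_mset (\<lambda>z. z / complex_of_real \<tau>) (spec M)"
  have "(\<Prod>z\<in>#filter_mset (\<lambda>z. cmod z > \<tau>) (spec M). (cmod z / \<tau>)\<^sup>2)
      = (\<Prod>\<mu>\<in>#filter_mset (\<lambda>\<mu>. cmod \<mu> > 1) A. (cmod \<mu>)\<^sup>2)"
    using \<open>\<tau> > 0\<close> by (simp add: A_def filter_mset_image_mset norm_divide image_mset.compositionality o_def)
  moreover have "det (1\<^sub>m n - (exp (\<i> * complex_of_real \<theta>) / complex_of_real \<tau>) \<cdot>\<^sub>m M)
      = (\<Prod>\<mu>\<in>#A. 1 - exp (\<i> * complex_of_real \<theta>) * \<mu>)" for \<theta>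
    using \<open>\<tau> > 0\<close>
    by (subst det_one_minus_smult_eq_prod_spec[OF assms(1)])
      (auto simp: A_def image_mset.compositionality o_def)
  ultimately show ?thesis
    using prod_outside_disc_le_expectation[of A] by simp
qed

end
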